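(* Let $f_1,\dots,f_s$ be nonzero elements of $\mathbf F=\mathbb K[\![x_1,\dots,x_n]\!]$ and $\mathbf A=\mathbb K[\![f_1,\dots,f_s]\!]$. Assume that $\mathrm{exp}(\mathbf A,a)$ is finitely generated for all $a\in U^n$ and that $\{\mathrm M(\mathbf A,a)\mid a\in U^n\}$ is a finite set. Let $S$ be a finitely generated subsemigroup of $\mathbb N^n$ such that $E_S=\{a\in U^n\mid\mathrm{exp}(\mathbf A,a)=S\}$ is nonempty, let $a\in E_S$, and let $\{g_1,\dots,g_r\}$ be the $a$-reduced canonical basis of $\mathbf A$ (which is also the $b$-reduced canonical basis of $\mathbf A$ for every $b\in E_S$). Let $\sim$ be the equivalence relation on $U^n$ defined by: $c\sim d$ if $\mathrm{in}(g_i,c)=\mathrm{in}(g_i,d)$ for all $i\in\{1,\dots,r\}$. Then $\sim$ defines on $U^n$ a finite partition into convex rational polyhedral cones, and $E_S$ is a union of some of these cones.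
   Context: $\mathbb K$ is a field, $n\ge 1$, $\underline x=(x_1,\dots,x_n)$, $\mathbf F=\mathbb K[\![x_1,\dots,x_n]\!]$, $U=\mathbb R_{>0}$. Fix a total well ordering $\prec$ on $\mathbb N^n$ compatible with sums. For $a\in U^n$ and a nonzero $f=\sum c_\alpha\underline x^\alpha\in\mathbf F$: $\mathrm{Supp}(f)=\{\alpha\mid c_\alpha\ne0\}$; $\nu(f,a)=\min\{a\cdot\alpha\mid\alpha\in\mathrm{Supp}(f)\}$; $\mathrm{in}(f,a)=\sum_{\alpha\in\mathrm{Supp}(f),\,a\cdot\alpha=\nu(f,a)}c_\alpha\underline x^\alpha$ (a polynomial); $\mathrm{exp}(f,a)=\max_\prec\mathrm{Supp}(\mathrm{in}(f,a))$; $\mathrm M(f,a)=c_{\mathrm{exp}(f,a)}\underline x^{\mathrm{exp}(f,a)}$. For $T\subseteq\mathbf F$, $\mathbb K[\![T]\!]$ is the closure, in the $(x_1,\dots,x_n)$-adic topology, of the $\mathbb K$-subalgebra of $\mathbf F$ generated by $T$ (for a finite set of series without constant term it is the set of all formal power series in them). $\mathrm M(\mathbf A,a)=\mathbb K[\![\mathrm M(f,a), f\in\mathbf A\setminus\{0\}]\!]$ and $\mathrm{exp}(\mathbf A,a)=\{\mathrm{exp}(f,a)\mid f\in\mathbf A\setminus\{0\}\}$, a subsemigroup of $\mathbb N^n$ containing $0$. A finite set $\{g_1,\dots,g_r\}\subseteq\mathbf A$ is an $a$-canonical basis of $\mathbf A$ if $\mathrm{exp}(\mathbf A,a)$ is generated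 by $\mathrm{exp}(g_1,a),\dots,\mathrm{exp}(g_r,a)$. It is minimal if $\{\mathrm M(g_1,a),\dots,\mathrm M(g_r,a)\}$ is a minimal set of generators of $\mathrm M(\mathbf A,a)$. It is reduced if it is minimal, each $\mathrm M(g_i,a)$ has coefficient $1$, and no $\alpha\in\mathrm{Supp}(g_i-\mathrm M(g_i,a))$ satisfies $\underline x^\alpha\in\mathrm M(\mathbf A,a)$. If $\mathrm{exp}(\mathbf A,a)$ is finitely generated, the $a$-reduced canonical basis exists and is unique. Cones are not required to be closed: a convex rational polyhedral cone in $U^n$ is a convex subset of $U^n$, stable under multiplication by positive reals, defined in $U^n$ by finitely many homogeneous linear equations and (strict or non-strict) inequalities with rational coefficients. *)

theory Defs
  imports "HOL-Analysis.Analysis"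
begin

section \<open>Formal power series in several variables\<close>

text \<open>Exponents are vectors in \<^typ>\<open>nat ^ 'n\<close>; the number of variables is the cardinality
  of the (nonempty, finite) index type \<open>'n\<close>.\<close>

typedef ('k, 'n::finite) mps = "UNIV :: (nat ^ 'n \<Rightarrow> 'k) set"
  morphisms mcoeff Mps ..

lemma mcoeff_Mps [simp]: "mcoeff (Mps c) = c"
  by (simp add: Mps_inverse)

lemma mps_eqI: "(\<And>\<alpha>. mcoeff f \<alpha> = mcoeff g \<alpha>) \<Longrightarrow> f = g"
  by (metis ext mcoeff_inject)

lemma finite_add_eq: "finite {(\<alpha>, \<beta>). \<alpha> + \<beta> = (\<gamma> :: nat ^ 'n)}"
proof -
  let ?X = "{\<alpha> :: nat ^ 'n. \<forall>i. \<alpha> $ i \<le> \<gamma> $ i}"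
  have "vec_nth ` ?X \<subseteq> (\<Pi>\<^sub>E i\<in>UNIV. {..\<gamma> $ i})"
    by (auto simp: PiE_def)
  then have "finite (vec_nth ` ?X)"
    by (rule finite_subset) (intro finite_PiE, auto)
  then have "finite ?X"
    by (rule finite_imageD) (auto simp: inj_on_def vec_eq_iff)
  then have "finite (?X \<times> ?X)" by simp
  then show ?thesis
    by (rule rev_finite_subset) (auto simp: vec_eq_iff, (metis le_add1 le_add2)+)
qed

instantiation mps :: (comm_ring_1, finite) comm_ring_1
begin

definition "0 = Mps (\<lambda>_. 0)"
definition "1 = Mps (\<lambda>\<alpha>. if \<alpha> = 0 then 1 else 0)"
definition "f + g = Mps (\<lambda>\<alpha>. mcoeff f \<alpha> + mcoeff g \<alpha>)"
definition "f - g = Mps (\<lambda>\<alpha>. mcoeff f \<alpha> - mcoeff g \<alpha>)"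
definition "- f = Mps (\<lambda>\<alpha>. - mcoeff f \<alpha>)"
definition "f * g =
  Mps (\<lambda>\<gamma>. \<Sum>(\<alpha>, \<beta>)\<in>{(\<alpha>, \<beta>). \<alpha> + \<beta> = \<gamma>}. mcoeff f \<alpha> * mcoeff g \<beta>)"

instance
proof
  fix f g h :: "('a, 'b) mps"
  show "f * g = g * f"
    unfolding times_mps_def
    by (rule arg_cong[where f = Mps], rule ext,
        rule sum.reindex_bij_witness[where i = prod.swap and j = prod.swap])
       (auto simp: ac_simps)
  show "f * g * h = f * (g * h)"
  proof (rule mps_eqI)
    fix \<delta> :: "nat ^ 'b"
    let ?P = "\<lambda>\<gamma> :: nat ^ 'b. {(\<alpha>, \<beta>). \<alpha> + \<beta> = \<gamma>}"
    have "mcoeff (f * g * h) \<delta> =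
        (\<Sum>p\<in>?P \<delta>. \<Sum>q\<in>?P (fst p). mcoeff f (fst q) * mcoeff g (snd q) * mcoeff h (snd p))"
      by (simp add: times_mps_def case_prod_beta sum_distrib_right)
    also have "\<dots> = (\<Sum>(p, q)\<in>(SIGMA p:?P \<delta>. ?P (fst p)).
        mcoeff f (fst q) * mcoeff g (snd q) * mcoeff h (snd p))"
      by (rule sum.Sigma) (auto simp: finite_add_eq)
    also have "\<dots> = (\<Sum>(p, q)\<in>(SIGMA p:?P \<delta>. ?P (snd p)).
        mcoeff f (fst p) * (mcoeff g (fst q) * mcoeff h (snd q)))"
      by (rule sum.reindex_bij_witness[where
            j = "\<lambda>(p, q). ((fst q, snd q + snd p), (snd q, snd p))" and
            i = "\<lambda>(p, q). ((fst p + fst q, snd q), (fst p, fst q))"])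
         (auto simp: ac_simps)
    also have "\<dots> =
        (\<Sum>p\<in>?P \<delta>. \<Sum>q\<in>?P (snd p). mcoeff f (fst p) * (mcoeff g (fst q) * mcoeff h (snd q)))"
      by (rule sum.Sigma[symmetric]) (auto simp: finite_add_eq)
    also have "\<dots> = mcoeff (f * (g * h)) \<delta>"
      by (simp add: times_mps_def case_prod_beta sum_distrib_left)
    finally show "mcoeff (f * g * h) \<delta> = mcoeff (f * (g * h)) \<delta>" .
  qed
  show "1 * f = f"
  proof (rule mps_eqI)
    fix \<gamma> :: "nat ^ 'b"
    have "mcoeff (1 * f) \<gamma> =
        (\<Sum>p\<in>{(\<alpha>, \<beta>). \<alpha> + \<beta> = \<gamma>}. (if fst p = 0 then 1 else 0) * mcoeff f (snd p))"
      by (simp add: times_mps_def one_mps_def case_prod_beta)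
    also have "\<dots> = (\<Sum>p\<in>{(0 :: nat ^ 'b, \<gamma>)}. (if fst p = 0 then 1 else 0) * mcoeff f (snd p))"
      by (rule sum.mono_neutral_right) (auto simp: finite_add_eq)
    finally show "mcoeff (1 * f) \<gamma> = mcoeff f \<gamma>" by simp
  qed
  show "(f + g) * h = f * h + g * h"
    by (rule mps_eqI)
       (simp add: times_mps_def plus_mps_def case_prod_beta distrib_right sum.distrib)
  show "(0 :: ('a, 'b) mps) \<noteq> 1"
    by (simp add: zero_mps_def one_mps_def Mps_inject fun_eq_iff exI[of _ 0])
qed (auto intro!: mps_eqI simp: zero_mps_def plus_mps_def minus_mps_def uminus_mps_def)

end

definition mps_monom :: "'k::zero \<Rightarrow> nat ^ 'n \<Rightarrow> ('k, 'n::finite) mps" where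
  "mps_monom c \<alpha> = Mps (\<lambda>\<beta>. if \<beta> = \<alpha> then c else 0)"

definition Supp :: "('k::zero, 'n::finite) mps \<Rightarrow> (nat ^ 'n) set" where
  "Supp f = {\<alpha>. mcoeff f \<alpha> \<noteq> 0}"


section \<open>The adic topology and complete subalgebras\<close>

text \<open>The \<open>N\<close>-th power of the ideal generated by the variables: the series without terms of total
  degree below \<open>N\<close>.\<close>

definition adic_ideal :: "nat \<Rightarrow> ('k::zero, 'n::finite) mps set" where
  "adic_ideal N = {f. \<forall>\<alpha>\<in>Supp f. N \<le> (\<Sum>i\<in>UNIV. \<alpha> $ i)}"

lemma adic_ideal_antimono: "M \<le> N \<Longrightarrow> adic_ideal N \<subseteq> adic_ideal M"
  by (auto simp: adic_ideal_def intro: order_trans)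

instantiation mps :: (comm_ring_1, finite) topological_space
begin

definition open_mps_def:
  "open (U :: ('a, 'b) mps set) \<longleftrightarrow> (\<forall>f\<in>U. \<exists>N. \<forall>g. g - f \<in> adic_ideal N \<longrightarrow> g \<in> U)"

instance
proof
  show "open (UNIV :: ('a, 'b) mps set)" by (simp add: open_mps_def)
  fix U V :: "('a, 'b) mps set"
  assume U: "open U" and V: "open V"
  show "open (U \<inter> V)"
    unfolding open_mps_def
  proof
    fix f assume "f \<in> U \<inter> V"
    then obtain M N where "\<forall>g. g - f \<in> adic_ideal M \<longrightarrow> g \<in> U" "\<forall>g. g - f \<in> adic_ideal N \<longrightarrow> g \<in> V"
      using U V unfolding open_mps_def by blast
    then have "\<forall>g. g - f \<in> adic_ideal (max M N) \<longrightarrow> g \<in> U \<inter> V"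
      using adic_ideal_antimono[of M "max M N"] adic_ideal_antimono[of N "max M N"] by auto
    then show "\<exists>N. \<forall>g. g - f \<in> adic_ideal N \<longrightarrow> g \<in> U \<inter> V" ..
  qed
next
  fix \<U> :: "('a, 'b) mps set set"
  assume "\<forall>U\<in>\<U>. open U"
  then show "open (\<Union>\<U>)" unfolding open_mps_def by (meson Union_iff)
qed

end

definition mps_subalgebra :: "('k::field, 'n::finite) mps set \<Rightarrow> bool" where
  "mps_subalgebra B \<longleftrightarrow> (\<forall>c. mps_monom c 0 \<in> B) \<and> (\<forall>f\<in>B. \<forall>g\<in>B. f + g \<in> B \<and> f * g \<in> B)"

definition power_series_algebra :: "('k::field, 'n::finite) mps set \<Rightarrow> ('k, 'n) mps set" where
  "power_series_algebra T = closure (mps_subalgebra hull T)"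


section \<open>Subsemigroups of exponents\<close>

text \<open>Subsemigroups are understood to contain \<open>0\<close>, which is generated as the empty sum.\<close>

definition subsemigroup :: "(nat ^ 'n::finite) set \<Rightarrow> bool" where
  "subsemigroup S \<longleftrightarrow> 0 \<in> S \<and> (\<forall>\<alpha>\<in>S. \<forall>\<beta>\<in>S. \<alpha> + \<beta> \<in> S)"

definition finitely_generated :: "(nat ^ 'n::finite) set \<Rightarrow> bool" where
  "finitely_generated S \<longleftrightarrow> (\<exists>X. finite X \<and> subsemigroup hull X = S)"


section \<open>Initial forms, leading monomials and canonical bases\<close>

definition pos_orthant :: "(real ^ 'n::finite) set" where
  "pos_orthant = {a. \<forall>i. 0 < a $ i}"

definition weight :: "real ^ 'n \<Rightarrow> nat ^ 'n::finite \<Rightarrow> real" where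
  "weight a \<alpha> = (\<Sum>i\<in>UNIV. a $ i * real (\<alpha> $ i))"

definition exponent_order :: "(nat ^ 'n::finite) rel \<Rightarrow> bool" where
  "exponent_order r \<longleftrightarrow>
     well_order_on UNIV r \<and> (\<forall>\<alpha> \<beta> \<gamma>. (\<alpha>, \<beta>) \<in> r \<longrightarrow> (\<alpha> + \<gamma>, \<beta> + \<gamma>) \<in> r)"

text \<open>For nonzero \<open>f\<close> and \<open>a\<close> in the positive orthant the least weight below is attained, and
  attained only finitely often.\<close>

definition min_weight :: "('k::zero, 'n::finite) mps \<Rightarrow> real ^ 'n \<Rightarrow> real" where
  "min_weight f a = (LEAST v. v \<in> weight a ` Supp f)"

definition initial_form :: "('k::zero, 'n::finite) mps \<Rightarrow> real ^ 'n \<Rightarrow> ('k, 'n) mps" where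
  "initial_form f a = Mps (\<lambda>\<alpha>. if weight a \<alpha> = min_weight f a then mcoeff f \<alpha> else 0)"

definition lead_exp ::
    "(nat ^ 'n) rel \<Rightarrow> ('k::zero, 'n::finite) mps \<Rightarrow> real ^ 'n \<Rightarrow> nat ^ 'n" where
  "lead_exp r f a = (THE \<alpha>. \<alpha> \<in> Supp (initial_form f a) \<and>
     (\<forall>\<beta>\<in>Supp (initial_form f a). (\<beta>, \<alpha>) \<in> r))"

definition lead_monom ::
    "(nat ^ 'n) rel \<Rightarrow> ('k::zero, 'n::finite) mps \<Rightarrow> real ^ 'n \<Rightarrow> ('k, 'n) mps" where
  "lead_monom r f a = mps_monom (mcoeff f (lead_exp r f a)) (lead_exp r f a)"

definition lead_exps ::
    "(nat ^ 'n) rel \<Rightarrow> ('k::field, 'n::finite) mps set \<Rightarrow> real ^ 'n \<Rightarrow> (nat ^ 'n) set" where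
  "lead_exps r A a = (\<lambda>f. lead_exp r f a) ` (A - {0})"

definition lead_algebra ::
    "(nat ^ 'n) rel \<Rightarrow> ('k::field, 'n::finite) mps set \<Rightarrow> real ^ 'n \<Rightarrow> ('k, 'n) mps set" where
  "lead_algebra r A a = power_series_algebra ((\<lambda>f. lead_monom r f a) ` (A - {0}))"

text \<open>Elements of a canonical basis are nonzero, since only these have a leading exponent.\<close>

definition canonical_basis ::
    "(nat ^ 'n) rel \<Rightarrow> ('k::field, 'n::finite) mps set \<Rightarrow> real ^ 'n \<Rightarrow> ('k, 'n) mps set \<Rightarrow> bool"
where
  "canonical_basis r A a G \<longleftrightarrow> finite G \<and> G \<subseteq> A - {0} \<and>
     subsemigroup hull ((\<lambda>g. lead_exp r g a) ` G) = lead_exps r A a"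

definition minimal_generators ::
    "('k::field, 'n::finite) mps set \<Rightarrow> ('k, 'n) mps set \<Rightarrow> bool" where
  "minimal_generators B T \<longleftrightarrow>
     power_series_algebra T = B \<and> (\<forall>T'. T' \<subset> T \<longrightarrow> power_series_algebra T' \<noteq> B)"

definition minimal_canonical_basis ::
    "(nat ^ 'n) rel \<Rightarrow> ('k::field, 'n::finite) mps set \<Rightarrow> real ^ 'n \<Rightarrow> ('k, 'n) mps set \<Rightarrow> bool"
where
  "minimal_canonical_basis r A a G \<longleftrightarrow> canonical_basis r A a G \<and>
     minimal_generators (lead_algebra r A a) ((\<lambda>g. lead_monom r g a) ` G)"

definition reduced_canonical_basis ::
    "(nat ^ 'n) rel \<Rightarrow> ('k::field, 'n::finite) mps set \<Rightarrow> real ^ 'n \<Rightarrow> ('k, 'n) mps set \<Rightarrow> bool"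
where
  "reduced_canonical_basis r A a G \<longleftrightarrow> minimal_canonical_basis r A a G \<and>
     (\<forall>g\<in>G. mcoeff g (lead_exp r g a) = 1 \<and>
        (\<forall>\<alpha>\<in>Supp (g - lead_monom r g a). mps_monom 1 \<alpha> \<notin> lead_algebra r A a))"


section \<open>The partition of the positive orthant\<close>

definition exp_region ::
    "(nat ^ 'n) rel \<Rightarrow> ('k::field, 'n::finite) mps set \<Rightarrow> (nat ^ 'n) set \<Rightarrow> (real ^ 'n) set" where
  "exp_region r A S = {a \<in> pos_orthant. lead_exps r A a = S}"

definition same_initial_forms :: "('k::zero, 'n::finite) mps set \<Rightarrow> (real ^ 'n) rel" where
  "same_initial_forms G = {(c, d). c \<in> pos_orthant \<and> d \<in> pos_orthant \<and>
     (\<forall>g\<in>G. initial_form g c = initial_form g d)}"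

text \<open>Cones live in the open orthant and need not be closed; in particular they need not contain
  the origin, unlike in the library notion \<^const>\<open>cone\<close>.\<close>

definition rational_polyhedral_cone :: "(real ^ 'n::finite) set \<Rightarrow> bool" where
  "rational_polyhedral_cone C \<longleftrightarrow>
     convex C \<and> (\<forall>t>0. \<forall>x\<in>C. t *\<^sub>R x \<in> C) \<and>
     (\<exists>E P Q. finite E \<and> finite P \<and> finite Q \<and> (\<forall>v\<in>E \<union> P \<union> Q. \<forall>i. v $ i \<in> \<rat>) \<and>
        C = {x \<in> pos_orthant. (\<forall>v\<in>E. v \<bullet> x = 0) \<and> (\<forall>v\<in>P. 0 < v \<bullet> x) \<and> (\<forall>v\<in>Q. 0 \<le> v \<bullet> x)})"

end

theory Submission
  imports Defs
begin

text \<open>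
  The equivalence classes are cones because an initial form sees only finitely many exponents. As
  the weight \<open>c\<close> is strictly positive, every exponent of \<^term>\<open>initial_form g c\<close> is minimal in
  \<^term>\<open>Supp g\<close> for the componentwise order, and by Dickson's lemma (\<open>Dickson\<close>) there are only
  finitely many minimal exponents. So there are finitely many initial forms, and prescribing one
  means prescribing which of finitely many exponents share the least weight: a conjunction of
  equations and strict inequalities \<open>c \<bullet> (\<beta> - \<alpha>) = 0\<close>, \<open>c \<bullet> (\<beta> - \<alpha>) > 0\<close> with integer
  coefficients (\<open>Supp_initial_form_eq_iff\<close>, \<open>initial_form_class_cone\<close>).

  The reduced basis \<open>G\<close> at \<open>a\<close> stays reduced at every \<open>b\<close> with the same semigroup \<open>S\<close> because
  \<open>lead_exp r g a\<close> is the only exponent of \<open>g \<in> G\<close> that lies in \<open>S\<close>, while \<open>lead_exp r g b\<close> is an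
  exponent of \<open>g\<close> in \<open>S\<close> as well (\<open>reduced_basis_lead_exp_eq\<close>). The algebra of leading monomials
  depends on \<open>S\<close> alone (\<open>lead_algebra_cong\<close>).

  The main point is that the region of \<open>S\<close> is saturated (\<open>lead_exps_eq_if_lead_exps_basis_eq\<close>). Let
  \<open>b\<close> lie in it and let \<open>c\<close> give the elements of \<open>G\<close> the same initial forms, hence the same leading
  exponents. Leading exponents are additive, so products of elements of \<open>G\<close> provide, for every
  \<open>s \<in> S\<close>, an element \<open>W s\<close> of the algebra with leading exponent \<open>s\<close> at \<open>b\<close> and also at \<open>c\<close>; in
  particular \<open>S\<close> consists of leading exponents at \<open>c\<close>. Conversely, let \<open>\<gamma>\<close> be the leading exponent
  of \<open>f\<close> at \<open>c\<close>. Repeatedly cancelling the leading term at \<open>b\<close>, whose exponent always lies in \<open>S\<close>,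
  approximates \<open>f\<close> by a finite linear combination \<open>p\<close> of the \<open>W s\<close>
  (\<open>subduction_approximation\<close>). After finitely many steps \<open>p\<close> agrees with \<open>f\<close> on the finite set of
  exponents that do not come after \<open>\<gamma>\<close> in the order at \<open>c\<close>, so \<open>p\<close> has leading exponent \<open>\<gamma>\<close> at \<open>c\<close>
  too. Since the \<open>W s\<close> have distinct leading exponents at \<open>c\<close>, that of \<open>p\<close> is one of these \<open>s\<close>
  (\<open>has_lead_combination\<close>), and \<open>\<gamma> \<in> S\<close>.
\<close>

section \<open>Weights of exponents\<close>

lemma weight_add: "weight a (\<alpha> + \<beta>) = weight a \<alpha> + weight a \<beta>"
  by (simp add: weight_def algebra_simps sum.distrib)

lemma weight_mono:
  assumes "a \<in> pos_orthant" "\<And>i. \<alpha> $ i \<le> \<beta> $ i"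
  shows "weight a \<alpha> \<le> weight a \<beta>"
  unfolding weight_def using assms
  by (intro sum_mono mult_left_mono) (auto simp: pos_orthant_def less_imp_le)

lemma weight_strict_mono:
  assumes "a \<in> pos_orthant" "\<And>i. \<alpha> $ i \<le> \<beta> $ i" "\<alpha> \<noteq> \<beta>"
  shows "weight a \<alpha> < weight a \<beta>"
proof -
  obtain j where "\<alpha> $ j \<noteq> \<beta> $ j" using assms(3) by (auto simp: vec_eq_iff)
  then have "a $ j * real (\<alpha> $ j) < a $ j * real (\<beta> $ j)"
    using assms(1,2) by (auto simp: pos_orthant_def order_less_le)
  then show ?thesis
    unfolding weight_def using assms(1,2)
    by (intro sum_strict_mono_ex1) (auto simp: pos_orthant_def less_imp_le intro!: mult_left_mono)
qed

lemma finite_exponents_below: "finite {\<beta> :: nat ^ 'n::finite. \<forall>i. \<beta> $ i \<le> \<gamma> $ i}"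
proof -
  have "{\<beta>. \<forall>i. \<beta> $ i \<le> \<gamma> $ i} \<subseteq> fst ` {(\<alpha>, \<beta>). \<alpha> + \<beta> = \<gamma>}"
  proof
    fix \<beta> assume "\<beta> \<in> {\<beta>. \<forall>i. \<beta> $ i \<le> \<gamma> $ i}"
    then have "\<beta> + (\<gamma> - \<beta>) = \<gamma>" by (simp add: vec_eq_iff)
    then show "\<beta> \<in> fst ` {(\<alpha>, \<beta>). \<alpha> + \<beta> = \<gamma>}" by force
  qed
  then show ?thesis using finite_add_eq finite_surj by blast
qed

lemma finite_weight_le:
  assumes "a \<in> pos_orthant"
  shows "finite {\<beta>. weight a \<beta> \<le> v}"
proof (rule finite_subset)
  show "{\<beta>. weight a \<beta> \<le> v} \<subseteq> {\<beta>. \<forall>i. \<beta> $ i \<le> (\<chi> i. nat \<lceil>v / a $ i\<rceil>) $ i}"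
  proof (intro subsetI CollectI allI)
    fix \<beta> i assume "\<beta> \<in> {\<beta>. weight a \<beta> \<le> v}"
    moreover have "a $ i * real (\<beta> $ i) \<le> weight a \<beta>"
      unfolding weight_def using assms by (intro member_le_sum) (auto simp: pos_orthant_def less_imp_le)
    ultimately have "a $ i * real (\<beta> $ i) \<le> v" by simp
    then have "real (\<beta> $ i) \<le> v / a $ i"
      using assms by (simp add: pos_orthant_def field_simps)
    then show "\<beta> $ i \<le> (\<chi> i. nat \<lceil>v / a $ i\<rceil>) $ i"
      by simp linarith
  qed
qed (rule finite_exponents_below)

section \<open>Coefficients of products\<close>

lemma Supp_eq_empty_iff: "Supp f = {} \<longleftrightarrow> f = (0 :: ('k::comm_ring_1, 'm::finite) mps)"
  by (auto simp: Supp_def zero_mps_def intro: mps_eqI)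

lemma mcoeff_mult:
  "mcoeff (f * g) \<gamma> = (\<Sum>(\<alpha>, \<beta>)\<in>{(\<alpha>, \<beta>). \<alpha> + \<beta> = \<gamma>}. mcoeff f \<alpha> * mcoeff g \<beta>)"
  by (simp add: times_mps_def)

lemma Supp_mult:
  assumes "\<gamma> \<in> Supp (f * g)"
  obtains \<alpha> \<beta> where "\<alpha> \<in> Supp f" "\<beta> \<in> Supp g" "\<gamma> = \<alpha> + \<beta>"
proof -
  have "(\<Sum>(\<alpha>, \<beta>)\<in>{(\<alpha>, \<beta>). \<alpha> + \<beta> = \<gamma>}. mcoeff f \<alpha> * mcoeff g \<beta>) \<noteq> 0"
    using assms by (simp add: Supp_def mcoeff_mult)
  then obtain p where "p \<in> {(\<alpha>, \<beta>). \<alpha> + \<beta> = \<gamma>}" "(case p of (\<alpha>, \<beta>) \<Rightarrow> mcoeff f \<alpha> * mcoeff g \<beta>) \<noteq> 0"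
    by (meson sum.neutral)
  then show ?thesis using that by (force simp: Supp_def)
qed

lemma mcoeff_const_mult: "mcoeff (mps_monom c 0 * f) \<gamma> = c * mcoeff (f :: ('k::comm_ring_1, 'm::finite) mps) \<gamma>"
proof -
  have "mcoeff (mps_monom c 0 * f) \<gamma> =
      (\<Sum>(\<alpha>, \<beta>)\<in>{(0 :: nat ^ 'm, \<gamma>)}. mcoeff (mps_monom c 0) \<alpha> * mcoeff f \<beta>)"
    unfolding mcoeff_mult
    by (rule sum.mono_neutral_right) (auto simp: finite_add_eq mps_monom_def split: if_splits)
  then show ?thesis by (simp add: mps_monom_def)
qed

lemma subalgebra_diff_const_mult:
  assumes "mps_subalgebra A" "f \<in> A" "g \<in> A"
  shows "f - mps_monom c 0 * g \<in> A"
proof -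
  have "f - mps_monom c 0 * g = f + mps_monom (- c) 0 * g"
    by (rule mps_eqI) (simp add: minus_mps_def plus_mps_def mcoeff_const_mult)
  moreover have "mps_monom (- c) 0 \<in> A" using assms(1) by (simp add: mps_subalgebra_def)
  ultimately show ?thesis using assms unfolding mps_subalgebra_def by metis
qed

section \<open>The total order refining a weight\<close>

text \<open>The order in which the leading exponent is the least element of the support: the initial form
  collects the least weight, and ties are broken in favour of the \<open>r\<close>-greatest exponent, hence the
  reversed pair.\<close>

definition weight_le :: "(nat ^ 'n::finite) rel \<Rightarrow> real ^ 'n \<Rightarrow> nat ^ 'n \<Rightarrow> nat ^ 'n \<Rightarrow> bool" where
  "weight_le r a \<alpha> \<beta> \<longleftrightarrow>
     weight a \<alpha> < weight a \<beta> \<or> weight a \<alpha> = weight a \<beta> \<and> (\<beta>, \<alpha>) \<in> r"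

text \<open>Initial segments are finite for positive weights, so this position embeds the order
  into the natural numbers; it is what one inducts on when leading terms are cancelled.\<close>

definition weight_rank :: "(nat ^ 'n::finite) rel \<Rightarrow> real ^ 'n \<Rightarrow> nat ^ 'n \<Rightarrow> nat" where
  "weight_rank r a \<alpha> = card {\<beta>. weight_le r a \<beta> \<alpha>}"

definition has_lead ::
    "(nat ^ 'n::finite) rel \<Rightarrow> real ^ 'n \<Rightarrow> ('k::zero, 'n) mps \<Rightarrow> nat ^ 'n \<Rightarrow> bool" where
  "has_lead r a f \<alpha> \<longleftrightarrow> \<alpha> \<in> Supp f \<and> (\<forall>\<beta>\<in>Supp f. weight_le r a \<alpha> \<beta>)"

context
  fixes r :: "(nat ^ 'n::finite) rel"
  assumes ord: "exponent_order r"
begin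

lemma exponent_order_linear:
  "(\<alpha>, \<alpha>) \<in> r" "(\<alpha>, \<beta>) \<in> r \<or> (\<beta>, \<alpha>) \<in> r"
  "(\<alpha>, \<beta>) \<in> r \<Longrightarrow> (\<beta>, \<alpha>) \<in> r \<Longrightarrow> \<alpha> = \<beta>"
  "(\<alpha>, \<beta>) \<in> r \<Longrightarrow> (\<beta>, \<gamma>) \<in> r \<Longrightarrow> (\<alpha>, \<gamma>) \<in> r"
  "(\<alpha>, \<beta>) \<in> r \<Longrightarrow> (\<alpha> + \<gamma>, \<beta> + \<gamma>) \<in> r"
proof -
  have w: "well_order_on UNIV r" and c: "\<And>\<alpha> \<beta> \<gamma>. (\<alpha>, \<beta>) \<in> r \<Longrightarrow> (\<alpha> + \<gamma>, \<beta> + \<gamma>) \<in> r"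
    using ord unfolding exponent_order_def by auto
  have l: "refl_on UNIV r" "trans r" "antisym r" "total_on UNIV r"
    using w by (auto simp: order_on_defs)
  show rf: "(\<alpha>, \<alpha>) \<in> r" for \<alpha> using l(1) by (auto simp: refl_on_def)
  show "(\<alpha>, \<beta>) \<in> r \<or> (\<beta>, \<alpha>) \<in> r" using l(4) rf by (cases "\<alpha> = \<beta>") (auto simp: total_on_def)
  show "(\<alpha>, \<beta>) \<in> r \<Longrightarrow> (\<beta>, \<alpha>) \<in> r \<Longrightarrow> \<alpha> = \<beta>" using l(3) by (auto dest: antisymD)
  show "(\<alpha>, \<beta>) \<in> r \<Longrightarrow> (\<beta>, \<gamma>) \<in> r \<Longrightarrow> (\<alpha>, \<gamma>) \<in> r" using l(2) by (rule transD)
  show "(\<alpha>, \<beta>) \<in> r \<Longrightarrow> (\<alpha> + \<gamma>, \<beta> + \<gamma>) \<in> r" by (rule c)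
qed

lemma weight_le_refl: "weight_le r a \<alpha> \<alpha>"
  by (simp add: weight_le_def exponent_order_linear)

lemma weight_le_total: "weight_le r a \<alpha> \<beta> \<or> weight_le r a \<beta> \<alpha>"
  using exponent_order_linear(2)[of \<alpha> \<beta>] by (auto simp: weight_le_def)

lemma weight_le_antisym: "weight_le r a \<alpha> \<beta> \<Longrightarrow> weight_le r a \<beta> \<alpha> \<Longrightarrow> \<alpha> = \<beta>"
  using exponent_order_linear(3)[of \<alpha> \<beta>] by (auto simp: weight_le_def)

lemma weight_le_trans: "weight_le r a \<alpha> \<beta> \<Longrightarrow> weight_le r a \<beta> \<gamma> \<Longrightarrow> weight_le r a \<alpha> \<gamma>"
  using exponent_order_linear(4)[of \<gamma> \<beta> \<alpha>] by (auto simp: weight_le_def)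

lemma weight_le_add: "weight_le r a \<alpha> \<beta> \<Longrightarrow> weight_le r a (\<alpha> + \<gamma>) (\<beta> + \<gamma>)"
  using exponent_order_linear(5)[of \<beta> \<alpha> \<gamma>] by (auto simp: weight_le_def weight_add)

lemma weight_le_add_both:
  assumes "weight_le r a \<alpha> \<alpha>'" "weight_le r a \<beta> \<beta>'"
  shows "weight_le r a (\<alpha> + \<beta>) (\<alpha>' + \<beta>')"
  using weight_le_trans[OF weight_le_add[OF assms(1), of \<beta>]
      weight_le_add[OF assms(2), of \<alpha>', unfolded add.commute[of _ \<alpha>']]] .

text \<open>Only the pair of least elements reaches the least sum. This is why the leading coefficient of a
  product receives a single contribution.\<close>

lemma weight_le_add_both_eq:
  assumes "weight_le r a \<alpha> \<alpha>'" "weight_le r a \<beta> \<beta>'" "\<alpha>' + \<beta>' = \<alpha> + \<beta>"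
  shows "\<alpha>' = \<alpha> \<and> \<beta>' = \<beta>"
proof -
  have "weight_le r a (\<alpha> + \<beta>) (\<alpha> + \<beta>')" "weight_le r a (\<alpha> + \<beta>') (\<alpha>' + \<beta>')"
    using weight_le_add_both assms(1,2) weight_le_refl by blast+
  then have "\<alpha> + \<beta> = \<alpha> + \<beta>'" using assms(3) weight_le_antisym by metis
  then show ?thesis using assms(3) by simp
qed

lemma finite_weight_le_segment:
  "a \<in> pos_orthant \<Longrightarrow> finite {\<beta>. weight_le r a \<beta> \<alpha>}"
  by (rule finite_subset[OF _ finite_weight_le[of a "weight a \<alpha>"]]) (auto simp: weight_le_def)

lemma weight_rank_le_iff:
  assumes "a \<in> pos_orthant"
  shows "weight_rank r a \<alpha> \<le> weight_rank r a \<beta> \<longleftrightarrow> weight_le r a \<alpha> \<beta>"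
proof
  show "weight_rank r a \<alpha> \<le> weight_rank r a \<beta>" if "weight_le r a \<alpha> \<beta>" for \<alpha> \<beta>
    unfolding weight_rank_def
    using that weight_le_trans by (intro card_mono finite_weight_le_segment assms) blast
  show "weight_le r a \<alpha> \<beta>" if "weight_rank r a \<alpha> \<le> weight_rank r a \<beta>"
  proof (rule ccontr)
    assume n: "\<not> weight_le r a \<alpha> \<beta>"
    then have "weight_le r a \<beta> \<alpha>" using weight_le_total by blast
    then have "{\<gamma>. weight_le r a \<gamma> \<beta>} \<subset> {\<gamma>. weight_le r a \<gamma> \<alpha>}"
      using n weight_le_refl weight_le_trans by blast
    then have "weight_rank r a \<beta> < weight_rank r a \<alpha>"
      unfolding weight_rank_def by (intro psubset_card_mono finite_weight_le_segment assms)
    with that show False by simp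
  qed
qed

lemma weight_rank_eq_iff:
  "a \<in> pos_orthant \<Longrightarrow> weight_rank r a \<alpha> = weight_rank r a \<beta> \<longleftrightarrow> \<alpha> = \<beta>"
  by (metis order_refl weight_le_antisym weight_rank_le_iff)

lemma ex_weight_le_least:
  assumes "a \<in> pos_orthant" "X \<noteq> {}"
  obtains \<alpha> where "\<alpha> \<in> X" "\<And>\<beta>. \<beta> \<in> X \<Longrightarrow> weight_le r a \<alpha> \<beta>"
proof -
  obtain x where "x \<in> X" using assms(2) by blast
  then obtain \<alpha> where "\<alpha> \<in> X" "\<forall>\<beta>. \<beta> \<in> X \<longrightarrow> weight_rank r a \<alpha> \<le> weight_rank r a \<beta>"
    using ex_has_least_nat[of "\<lambda>x. x \<in> X" x "weight_rank r a"] by blast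
  then show ?thesis using that weight_rank_le_iff[OF assms(1)] by blast
qed

section \<open>Leading exponents\<close>

lemma has_lead_imp_lead_exp:
  assumes "has_lead r a f \<alpha>"
  shows "lead_exp r f a = \<alpha>"
proof -
  have m: "min_weight f a = weight a \<alpha>"
    unfolding min_weight_def
    using assms by (intro Least_equality) (auto simp: has_lead_def weight_le_def)
  have s: "\<beta> \<in> Supp (initial_form f a) \<longleftrightarrow> \<beta> \<in> Supp f \<and> weight a \<beta> = weight a \<alpha>" for \<beta>
    by (auto simp: initial_form_def Supp_def m)
  show ?thesis
    unfolding lead_exp_def s
  proof (rule the_equality)
    show "(\<alpha> \<in> Supp f \<and> weight a \<alpha> = weight a \<alpha>) \<and>
      (\<forall>\<beta>\<in>Supp (initial_form f a). (\<beta>, \<alpha>) \<in> r)"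
      using assms s by (fastforce simp: has_lead_def weight_le_def)
    fix \<beta>
    assume "(\<beta> \<in> Supp f \<and> weight a \<beta> = weight a \<alpha>) \<and>
      (\<forall>\<gamma>\<in>Supp (initial_form f a). (\<gamma>, \<beta>) \<in> r)"
    then have "weight_le r a \<beta> \<alpha>" "weight_le r a \<alpha> \<beta>"
      using assms s by (auto simp: has_lead_def weight_le_def)
    then show "\<beta> = \<alpha>" by (rule weight_le_antisym)
  qed
qed

lemma has_lead_lead_exp:
  fixes f :: "('k::comm_ring_1, 'n) mps"
  assumes "a \<in> pos_orthant" "f \<noteq> 0"
  shows "has_lead r a f (lead_exp r f a)"
proof -
  obtain \<alpha> where "has_lead r a f \<alpha>"
    using ex_weight_le_least[OF assms(1), of "Supp f"] assms(2) unfolding has_lead_def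
    by (metis Supp_eq_empty_iff)
  with has_lead_imp_lead_exp show ?thesis by metis
qed

lemma has_lead_imp_mem_lead_exps:
  fixes f :: "('k::field, 'n) mps"
  assumes "f \<in> A" "has_lead r a f \<alpha>"
  shows "\<alpha> \<in> lead_exps r A a"
proof -
  have "f \<noteq> 0" using assms(2) Supp_eq_empty_iff[of f] by (auto simp: has_lead_def)
  then show ?thesis
    using assms has_lead_imp_lead_exp[OF assms(2)] by (auto simp: lead_exps_def)
qed

lemma has_lead_mult:
  fixes f g :: "('k::field, 'n) mps"
  assumes f: "has_lead r a f \<alpha>" and g: "has_lead r a g \<beta>"
  shows "has_lead r a (f * g) (\<alpha> + \<beta>)"
  unfolding has_lead_def
proof
  have "mcoeff (f * g) (\<alpha> + \<beta>) = (\<Sum>(p, q)\<in>{(\<alpha>, \<beta>)}. mcoeff f p * mcoeff g q)"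
    unfolding mcoeff_mult
  proof (rule sum.mono_neutral_right)
    show "\<forall>x\<in>{(p, q). p + q = \<alpha> + \<beta>} - {(\<alpha>, \<beta>)}. (case x of (p, q) \<Rightarrow> mcoeff f p * mcoeff g q) = 0"
    proof
      fix x assume "x \<in> {(p, q). p + q = \<alpha> + \<beta>} - {(\<alpha>, \<beta>)}"
      then obtain p q where x: "x = (p, q)" and e: "p + q = \<alpha> + \<beta>" and n: "(p, q) \<noteq> (\<alpha>, \<beta>)"
        by auto
      show "(case x of (p, q) \<Rightarrow> mcoeff f p * mcoeff g q) = 0"
      proof (rule ccontr)
        assume "(case x of (p, q) \<Rightarrow> mcoeff f p * mcoeff g q) \<noteq> 0"
        then have "mcoeff f p * mcoeff g q \<noteq> 0" by (simp add: x)
        then have "p \<in> Supp f" "q \<in> Supp g" by (auto simp: Supp_def)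
        then have "weight_le r a \<alpha> p" "weight_le r a \<beta> q" using f g by (auto simp: has_lead_def)
        with weight_le_add_both_eq e n show False by blast
      qed
    qed
  qed (auto simp: finite_add_eq)
  then show "\<alpha> + \<beta> \<in> Supp (f * g)" using f g by (auto simp: has_lead_def Supp_def)
  show "\<forall>\<gamma>\<in>Supp (f * g). weight_le r a (\<alpha> + \<beta>) \<gamma>"
    using f g by (auto elim!: Supp_mult intro!: weight_le_add_both simp: has_lead_def)
qed

lemma has_lead_const_mult:
  fixes f :: "('k::field, 'n) mps"
  shows "c \<noteq> 0 \<Longrightarrow> has_lead r a f \<alpha> \<Longrightarrow> has_lead r a (mps_monom c 0 * f) \<alpha>"
  by (auto simp: has_lead_def Supp_def mcoeff_const_mult)

text \<open>The leading terms cannot cancel: among the summands with nonzero coefficient, the one whose leading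
  exponent comes first contributes a coefficient there to which no other summand contributes.\<close>

lemma has_lead_combination:
  fixes p :: "('k::field, 'n) mps"
  assumes c: "c \<in> pos_orthant" and T: "finite T"
    and W: "\<And>s. s \<in> T \<Longrightarrow> has_lead r c (W s) s"
    and p: "\<And>\<alpha>. mcoeff p \<alpha> = (\<Sum>s\<in>T. d s * mcoeff (W s) \<alpha>)"
    and "p \<noteq> 0"
  obtains t where "t \<in> T" "has_lead r c p t"
proof -
  have "{s\<in>T. d s \<noteq> 0} \<noteq> {}"
  proof
    assume e: "{s\<in>T. d s \<noteq> 0} = {}"
    have "mcoeff p \<alpha> = 0" for \<alpha> unfolding p using e by (intro sum.neutral) auto
    with \<open>p \<noteq> 0\<close> show False by (auto simp: zero_mps_def intro: mps_eqI)
  qed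
  from ex_weight_le_least[OF c this] obtain t where "t \<in> {s\<in>T. d s \<noteq> 0}" and
      "\<And>s. s \<in> {s\<in>T. d s \<noteq> 0} \<Longrightarrow> weight_le r c t s"
    by blast
  then have t: "t \<in> T" "d t \<noteq> 0" and
      least: "\<And>s. s \<in> T \<Longrightarrow> d s \<noteq> 0 \<Longrightarrow> weight_le r c t s"
    by auto
  have "has_lead r c p t"
    unfolding has_lead_def
  proof
    have "mcoeff p t = (\<Sum>s\<in>{t}. d s * mcoeff (W s) t)"
      unfolding p
    proof (rule sum.mono_neutral_right)
      show "\<forall>s\<in>T - {t}. d s * mcoeff (W s) t = 0"
      proof
        fix s assume s: "s \<in> T - {t}"
        show "d s * mcoeff (W s) t = 0"
        proof (rule ccontr)
          assume "d s * mcoeff (W s) t \<noteq> 0"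
          then have "weight_le r c s t" "weight_le r c t s"
            using W[of s] s least[of s] by (auto simp: has_lead_def Supp_def)
          with weight_le_antisym s show False by blast
        qed
      qed
    qed (use T t in auto)
    then show "t \<in> Supp p" using t W[of t] by (auto simp: has_lead_def Supp_def)
    show "\<forall>\<beta>\<in>Supp p. weight_le r c t \<beta>"
    proof
      fix \<beta> assume "\<beta> \<in> Supp p"
      then have "(\<Sum>s\<in>T. d s * mcoeff (W s) \<beta>) \<noteq> 0" by (simp add: Supp_def p)
      then obtain s where s: "s \<in> T" "d s * mcoeff (W s) \<beta> \<noteq> 0" by (meson sum.neutral)
      then have "weight_le r c s \<beta>" using W[of s] by (auto simp: has_lead_def Supp_def)
      with s least show "weight_le r c t \<beta>" by (auto intro: weight_le_trans)
    qed
  qed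
  with t that show ?thesis by blast
qed

text \<open>Let \<open>p\<close> agree with \<open>f\<close> at all positions below \<open>k\<close>. If they differ at position \<open>k\<close>, then the
  exponent there is the leading exponent of \<open>p - f\<close>, so it belongs to the semigroup and a multiple of
  the corresponding \<open>W\<close> removes the difference without disturbing earlier positions.\<close>

lemma subduction_approximation:
  fixes A :: "('k::field, 'n) mps set"
  assumes b: "b \<in> pos_orthant" and A: "mps_subalgebra A"
    and W: "\<And>s. s \<in> lead_exps r A b \<Longrightarrow> W s \<in> A \<and> has_lead r b (W s) s"
    and f: "f \<in> A"
  shows "\<exists>T d p. finite T \<and> T \<subseteq> lead_exps r A b \<and> (\<forall>s\<in>T. weight_rank r b s < k) \<and>
    p \<in> A \<and> (\<forall>\<alpha>. mcoeff p \<alpha> = (\<Sum>s\<in>T. d s * mcoeff (W s) \<alpha>)) \<and>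
    (\<forall>\<alpha>. weight_rank r b \<alpha> < k \<longrightarrow> mcoeff p \<alpha> = mcoeff f \<alpha>)"
proof (induction k)
  case 0
  have "mps_monom 0 0 \<in> A" using A by (simp add: mps_subalgebra_def)
  then show ?case by (intro exI[of _ "{}"] exI[of _ "mps_monom 0 0"]) (auto simp: mps_monom_def)
next
  case (Suc k)
  then obtain T d p where T: "finite T" "T \<subseteq> lead_exps r A b" "\<forall>s\<in>T. weight_rank r b s < k"
    and p: "p \<in> A" "\<And>\<alpha>. mcoeff p \<alpha> = (\<Sum>s\<in>T. d s * mcoeff (W s) \<alpha>)"
    and pf: "\<And>\<alpha>. weight_rank r b \<alpha> < k \<Longrightarrow> mcoeff p \<alpha> = mcoeff f \<alpha>" by blast
  show ?case
  proof (cases "\<exists>\<alpha>. weight_rank r b \<alpha> = k \<and> mcoeff p \<alpha> \<noteq> mcoeff f \<alpha>")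
    case False
    then have "mcoeff p \<alpha> = mcoeff f \<alpha>" if "weight_rank r b \<alpha> < Suc k" for \<alpha>
      using that pf[of \<alpha>] by (cases "weight_rank r b \<alpha> = k") auto
    moreover have "\<forall>s\<in>T. weight_rank r b s < Suc k" using T(3) by auto
    ultimately show ?thesis using T(1,2) p by (intro exI[of _ T] exI[of _ d] exI[of _ p]) blast
  next
    case True
    then obtain \<alpha> where \<alpha>: "weight_rank r b \<alpha> = k" "mcoeff p \<alpha> \<noteq> mcoeff f \<alpha>" by blast
    define h where "h = p - mps_monom 1 0 * f"
    have hc: "mcoeff h \<beta> = mcoeff p \<beta> - mcoeff f \<beta>" for \<beta>
      by (simp add: h_def minus_mps_def mcoeff_const_mult)
    have "h \<in> A" unfolding h_def by (rule subalgebra_diff_const_mult[OF A p(1) f])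
    moreover have h: "has_lead r b h \<alpha>"
      unfolding has_lead_def
    proof
      show "\<alpha> \<in> Supp h" using \<alpha> by (simp add: Supp_def hc)
      show "\<forall>\<beta>\<in>Supp h. weight_le r b \<alpha> \<beta>"
        using pf \<alpha>(1) weight_rank_le_iff[OF b] by (force simp: Supp_def hc)
    qed
    ultimately have \<alpha>S: "\<alpha> \<in> lead_exps r A b" by (rule has_lead_imp_mem_lead_exps)
    have nT: "\<alpha> \<notin> T" using T(3) \<alpha>(1) by auto
    define e where "e = mcoeff h \<alpha> / mcoeff (W \<alpha>) \<alpha>"
    have nz: "mcoeff (W \<alpha>) \<alpha> \<noteq> 0" using W[OF \<alpha>S] by (simp add: has_lead_def Supp_def)
    define q where "q = p - mps_monom e 0 * W \<alpha>"
    have qc: "mcoeff q \<beta> = mcoeff p \<beta> - e * mcoeff (W \<alpha>) \<beta>" for \<beta>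
      by (simp add: q_def minus_mps_def mcoeff_const_mult)
    show ?thesis
    proof (intro exI conjI allI impI)
      show "finite (insert \<alpha> T)" "insert \<alpha> T \<subseteq> lead_exps r A b"
        "\<forall>s\<in>insert \<alpha> T. weight_rank r b s < Suc k"
        using T \<alpha>(1) \<alpha>S by auto
      show "q \<in> A" unfolding q_def using subalgebra_diff_const_mult[OF A p(1)] W[OF \<alpha>S] by blast
      show "mcoeff q \<beta> = (\<Sum>s\<in>insert \<alpha> T. (d(\<alpha> := - e)) s * mcoeff (W s) \<beta>)" for \<beta>
      proof -
        have "(\<Sum>s\<in>T. (d(\<alpha> := - e)) s * mcoeff (W s) \<beta>) = mcoeff p \<beta>"
          unfolding p(2) using nT by (intro sum.cong) auto
        then show ?thesis using T(1) nT by (simp add: qc)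
      qed
      fix \<beta> assume \<beta>: "weight_rank r b \<beta> < Suc k"
      show "mcoeff q \<beta> = mcoeff f \<beta>"
      proof (cases "\<beta> = \<alpha>")
        case True
        then show ?thesis using nz by (simp add: qc e_def hc)
      next
        case False
        then have lt: "weight_rank r b \<beta> < k"
          using \<beta> \<alpha>(1) weight_rank_eq_iff[OF b, of \<beta> \<alpha>] by linarith
        then have "\<not> weight_le r b \<alpha> \<beta>" using weight_rank_le_iff[OF b, of \<alpha> \<beta>] \<alpha>(1) by auto
        then have "mcoeff (W \<alpha>) \<beta> = 0" using W[OF \<alpha>S] by (auto simp: has_lead_def Supp_def)
        then show ?thesis using pf[OF lt] by (simp add: qc)
      qed
    qed
  qed
qed

text \<open>Passing from \<open>b\<close> to \<open>c\<close> creates no new leading exponents: one at \<open>c\<close> depends on finitely many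
  coefficients only, and those are matched by finitely many cancellation steps at \<open>b\<close>.\<close>

lemma lead_exps_eq_if_lead_exps_basis_eq:
  fixes A :: "('k::field, 'n) mps set"
  assumes b: "b \<in> pos_orthant" and c: "c \<in> pos_orthant" and A: "mps_subalgebra A"
    and G: "G \<subseteq> A - {0}" "subsemigroup hull ((\<lambda>g. lead_exp r g b) ` G) = lead_exps r A b"
    and eq: "\<And>g. g \<in> G \<Longrightarrow> lead_exp r g c = lead_exp r g b"
  shows "lead_exps r A c = lead_exps r A b"
proof -
  \<comment> \<open>exponents that are leading exponents of one element for both weights; they form a semigroup\<close>
  define P where "P = {s. \<exists>h\<in>A. has_lead r b h s \<and> has_lead r c h s}"
  have "subsemigroup P"
    unfolding subsemigroup_def
  proof (intro conjI ballI)
    have "has_lead r a (mps_monom (1::'k) 0) 0" for a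
      by (auto simp: has_lead_def Supp_def mps_monom_def weight_le_refl)
    moreover have "mps_monom 1 0 \<in> A" using A by (simp add: mps_subalgebra_def)
    ultimately show "0 \<in> P" unfolding P_def by blast
    fix \<alpha> \<beta> assume "\<alpha> \<in> P" "\<beta> \<in> P"
    then show "\<alpha> + \<beta> \<in> P"
      using A has_lead_mult unfolding P_def mps_subalgebra_def by blast
  qed
  moreover have "(\<lambda>g. lead_exp r g b) ` G \<subseteq> P"
  proof (rule image_subsetI)
    fix g assume "g \<in> G"
    then have "g \<in> A" "has_lead r b g (lead_exp r g b)" "has_lead r c g (lead_exp r g b)"
      using G(1) eq has_lead_lead_exp[OF b, of g] has_lead_lead_exp[OF c, of g] by auto
    then show "lead_exp r g b \<in> P" unfolding P_def by blast
  qed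
  ultimately have "lead_exps r A b \<subseteq> P" using G(2) hull_minimal by metis
  then have "\<forall>s\<in>lead_exps r A b. \<exists>h. h \<in> A \<and> has_lead r b h s \<and> has_lead r c h s"
    unfolding P_def by blast
  then obtain W where W: "\<And>s. s \<in> lead_exps r A b \<Longrightarrow> W s \<in> A \<and> has_lead r b (W s) s \<and> has_lead r c (W s) s"
    by (metis (no_types))
  show ?thesis
  proof (intro equalityI subsetI)
    fix s assume "s \<in> lead_exps r A b"
    then have "W s \<in> A" "has_lead r c (W s) s" using W by auto
    then show "s \<in> lead_exps r A c" by (rule has_lead_imp_mem_lead_exps)
  next
    fix \<gamma> assume "\<gamma> \<in> lead_exps r A c"
    then obtain f where f: "f \<in> A" "has_lead r c f \<gamma>"
      using has_lead_lead_exp[OF c] by (auto simp: lead_exps_def)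
    \<comment> \<open>below position \<open>k\<close> at \<open>b\<close> lie all exponents up to \<open>\<gamma>\<close> in the order at \<open>c\<close>\<close>
    obtain k where k: "\<And>\<alpha>. weight_le r c \<alpha> \<gamma> \<Longrightarrow> weight_rank r b \<alpha> < k"
      using finite_weight_le_segment[OF c, of \<gamma>]
      by (metis (mono_tags, lifting) finite_imageI finite_nat_set_iff_bounded imageI mem_Collect_eq)
    obtain T d p where T: "finite T" "T \<subseteq> lead_exps r A b"
      and p: "\<And>\<alpha>. mcoeff p \<alpha> = (\<Sum>s\<in>T. d s * mcoeff (W s) \<alpha>)"
      and pf: "\<And>\<alpha>. weight_rank r b \<alpha> < k \<Longrightarrow> mcoeff p \<alpha> = mcoeff f \<alpha>"
      using subduction_approximation[OF b A _ f(1), of W k] W by blast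
    have \<gamma>p: "\<gamma> \<in> Supp p"
      using pf[OF k[OF weight_le_refl]] f(2) by (simp add: has_lead_def Supp_def)
    then have "p \<noteq> 0" using Supp_eq_empty_iff by blast
    then obtain t where t: "t \<in> T" "has_lead r c p t"
      using has_lead_combination[OF c T(1) _ p] W T(2) by blast
    then have le: "weight_le r c t \<gamma>" using \<gamma>p by (simp add: has_lead_def)
    then have "t \<in> Supp f" using pf[OF k] t(2) by (simp add: has_lead_def Supp_def)
    then have "t = \<gamma>" using f(2) le by (auto simp: has_lead_def intro: weight_le_antisym)
    then show "\<gamma> \<in> lead_exps r A b" using t T by blast
  qed
qed

section \<open>Canonical bases of subalgebras\<close>

text \<open>Rescaling an element realises every nonzero coefficient of its leading monomial. So the set of
  leading monomials, and with it the algebra that they generate, is determined by the leading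
  exponents.\<close>

lemma lead_monoms_eq:
  fixes A :: "('k::field, 'n) mps set"
  assumes a: "a \<in> pos_orthant" and A: "mps_subalgebra A"
  shows "(\<lambda>f. lead_monom r f a) ` (A - {0}) = {mps_monom c \<alpha> | c \<alpha>. c \<noteq> 0 \<and> \<alpha> \<in> lead_exps r A a}"
proof (intro equalityI subsetI)
  fix m assume "m \<in> (\<lambda>f. lead_monom r f a) ` (A - {0})"
  then obtain f where f: "f \<in> A" "f \<noteq> 0" "m = lead_monom r f a" by blast
  have "has_lead r a f (lead_exp r f a)" by (rule has_lead_lead_exp[OF a f(2)])
  then have "mcoeff f (lead_exp r f a) \<noteq> 0" by (simp add: has_lead_def Supp_def)
  moreover have "lead_exp r f a \<in> lead_exps r A a" using f by (simp add: lead_exps_def)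
  ultimately show "m \<in> {mps_monom c \<alpha> | c \<alpha>. c \<noteq> 0 \<and> \<alpha> \<in> lead_exps r A a}"
    using f(3) unfolding lead_monom_def by blast
next
  fix m assume "m \<in> {mps_monom c \<alpha> | c \<alpha>. c \<noteq> (0::'k) \<and> \<alpha> \<in> lead_exps r A a}"
  then obtain c \<alpha> where m: "m = mps_monom c \<alpha>" "c \<noteq> 0" "\<alpha> \<in> lead_exps r A a" by blast
  then obtain f where f: "f \<in> A" "f \<noteq> 0" "\<alpha> = lead_exp r f a" by (auto simp: lead_exps_def)
  have l: "has_lead r a f \<alpha>" unfolding f(3) by (rule has_lead_lead_exp[OF a f(2)])
  define h where "h = mps_monom (c / mcoeff f \<alpha>) 0 * f"
  have nz: "mcoeff f \<alpha> \<noteq> 0" using l by (simp add: has_lead_def Supp_def)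
  then have hl: "has_lead r a h \<alpha>" unfolding h_def using m(2) l by (intro has_lead_const_mult) auto
  have "lead_monom r h a = m"
    using has_lead_imp_lead_exp[OF hl] nz m(1) by (simp add: lead_monom_def h_def mcoeff_const_mult)
  moreover have "h \<in> A" unfolding h_def using A f(1) by (simp add: mps_subalgebra_def)
  moreover have "h \<noteq> 0" using hl Supp_eq_empty_iff[of h] by (auto simp: has_lead_def)
  ultimately show "m \<in> (\<lambda>f. lead_monom r f a) ` (A - {0})" by blast
qed

lemma lead_algebra_cong:
  fixes A :: "('k::field, 'n) mps set"
  assumes "a \<in> pos_orthant" "b \<in> pos_orthant" "mps_subalgebra A" "lead_exps r A b = lead_exps r A a"
  shows "lead_algebra r A b = lead_algebra r A a"
  unfolding lead_algebra_def using assms by (simp add: lead_monoms_eq)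

lemma monom_mem_lead_algebra:
  fixes A :: "('k::field, 'n) mps set"
  assumes "a \<in> pos_orthant" "mps_subalgebra A" "\<alpha> \<in> lead_exps r A a"
  shows "mps_monom 1 \<alpha> \<in> lead_algebra r A a"
proof -
  have "mps_monom 1 \<alpha> \<in> (\<lambda>f. lead_monom r f a) ` (A - {0})"
    unfolding lead_monoms_eq[OF assms(1,2)] using assms(3)
    by (intro CollectI exI[of _ 1] exI[of _ \<alpha>]) auto
  then show ?thesis
    unfolding lead_algebra_def power_series_algebra_def
    using hull_subset closure_subset by (metis (no_types) subsetD)
qed

text \<open>A leading exponent of \<open>g\<close> at \<open>b\<close> lies in the common semigroup, so its monomial lies in the algebra
  of leading monomials at \<open>a\<close>. Reducedness leaves only one such exponent in the support of \<open>g\<close>.\<close>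

lemma reduced_basis_lead_exp_eq:
  fixes A :: "('k::field, 'n) mps set"
  assumes a: "a \<in> pos_orthant" and b: "b \<in> pos_orthant" and A: "mps_subalgebra A"
    and S: "lead_exps r A b = lead_exps r A a"
    and G: "reduced_canonical_basis r A a G" and g: "g \<in> G"
  shows "lead_exp r g b = lead_exp r g a"
proof (rule ccontr)
  assume ne: "lead_exp r g b \<noteq> lead_exp r g a"
  let ?\<beta> = "lead_exp r g b"
  have gA: "g \<in> A" "g \<noteq> 0"
    using G g unfolding reduced_canonical_basis_def minimal_canonical_basis_def canonical_basis_def
    by auto
  have "?\<beta> \<in> lead_exps r A a" unfolding S[symmetric] using gA by (simp add: lead_exps_def)
  then have "mps_monom 1 ?\<beta> \<in> lead_algebra r A a" by (rule monom_mem_lead_algebra[OF a A])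
  moreover have "?\<beta> \<in> Supp g" using has_lead_lead_exp[OF b gA(2)] by (simp add: has_lead_def)
  then have "?\<beta> \<in> Supp (g - lead_monom r g a)"
    using ne by (simp add: Supp_def minus_mps_def lead_monom_def mps_monom_def)
  ultimately show False using G g unfolding reduced_canonical_basis_def by blast
qed

lemma reduced_canonical_basis_cong:
  fixes A :: "('k::field, 'n) mps set"
  assumes a: "a \<in> pos_orthant" and b: "b \<in> pos_orthant" and A: "mps_subalgebra A"
    and S: "lead_exps r A b = lead_exps r A a"
    and G: "reduced_canonical_basis r A a G"
  shows "reduced_canonical_basis r A b G"
proof -
  have e: "lead_exp r g b = lead_exp r g a" if "g \<in> G" for g
    by (rule reduced_basis_lead_exp_eq[OF assms that])
  then have m: "lead_monom r g b = lead_monom r g a" if "g \<in> G" for g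
    using that by (simp add: lead_monom_def)
  have "(\<lambda>g. lead_exp r g b) ` G = (\<lambda>g. lead_exp r g a) ` G"
    "(\<lambda>g. lead_monom r g b) ` G = (\<lambda>g. lead_monom r g a) ` G"
    using e m by (auto intro!: image_cong)
  then show ?thesis
    using G S lead_algebra_cong[OF a b A S] e m
    unfolding reduced_canonical_basis_def minimal_canonical_basis_def canonical_basis_def by simp
qed

end

section \<open>Closures of subalgebras\<close>

lemma diff_mem_adic_ideal_iff:
  "g - f \<in> adic_ideal N \<longleftrightarrow>
    (\<forall>\<alpha>. (\<Sum>i\<in>UNIV. \<alpha> $ i) < N \<longrightarrow> mcoeff g \<alpha> = mcoeff (f :: ('k::comm_ring_1, 'n::finite) mps) \<alpha>)"
  by (auto simp: adic_ideal_def Supp_def minus_mps_def not_less[symmetric])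

lemma mem_closure_iff_adic:
  "f \<in> closure B \<longleftrightarrow> (\<forall>N. \<exists>g\<in>B. g - f \<in> adic_ideal N)"
  for f :: "('k::comm_ring_1, 'n::finite) mps"
proof
  assume f: "f \<in> closure B"
  show "\<forall>N. \<exists>g\<in>B. g - f \<in> adic_ideal N"
  proof
    fix N
    have "open {g. g - f \<in> adic_ideal N}"
      unfolding open_mps_def by (auto simp: diff_mem_adic_ideal_iff intro!: exI[of _ N])
    moreover have "f \<in> {g. g - f \<in> adic_ideal N}" by (simp add: diff_mem_adic_ideal_iff)
    ultimately show "\<exists>g\<in>B. g - f \<in> adic_ideal N"
      using f unfolding closure_iff_nhds_not_empty by blast
  qed
next
  assume "\<forall>N. \<exists>g\<in>B. g - f \<in> adic_ideal N"
  then show "f \<in> closure B"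
    unfolding closure_iff_nhds_not_empty open_mps_def by blast
qed

text \<open>The coefficient of a product at an exponent involves coefficients of the factors at exponents of no
  larger total degree.\<close>

lemma mult_cong_adic_ideal:
  fixes f g :: "('k::comm_ring_1, 'n::finite) mps"
  assumes "f' - f \<in> adic_ideal N" "g' - g \<in> adic_ideal N"
  shows "f' * g' - f * g \<in> adic_ideal N"
  unfolding diff_mem_adic_ideal_iff mcoeff_mult
proof (intro allI impI sum.cong refl)
  fix \<gamma> :: "nat ^ 'n" and x
  assume \<gamma>: "(\<Sum>i\<in>UNIV. \<gamma> $ i) < N" and "x \<in> {(\<alpha>, \<beta>). \<alpha> + \<beta> = \<gamma>}"
  then obtain \<alpha> \<beta> where x: "x = (\<alpha>, \<beta>)" "\<alpha> + \<beta> = \<gamma>" by auto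
  then have "(\<Sum>i\<in>UNIV. \<alpha> $ i) < N" "(\<Sum>i\<in>UNIV. \<beta> $ i) < N"
    using \<gamma> by (auto simp: sum.distrib)
  then show "(case x of (\<alpha>, \<beta>) \<Rightarrow> mcoeff f' \<alpha> * mcoeff g' \<beta>) =
      (case x of (\<alpha>, \<beta>) \<Rightarrow> mcoeff f \<alpha> * mcoeff g \<beta>)"
    using assms by (simp add: x(1) diff_mem_adic_ideal_iff)
qed

lemma mps_subalgebra_closure:
  assumes "mps_subalgebra B"
  shows "mps_subalgebra (closure B)"
  unfolding mps_subalgebra_def
proof (intro conjI ballI allI)
  show "mps_monom c 0 \<in> closure B" for c
    using assms closure_subset unfolding mps_subalgebra_def by blast
  fix f g assume f: "f \<in> closure B" and g: "g \<in> closure B"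
  have "\<exists>h\<in>B. h - (f + g) \<in> adic_ideal N" "\<exists>h\<in>B. h - f * g \<in> adic_ideal N" for N
  proof -
    obtain f' g' where h: "f' \<in> B" "g' \<in> B" "f' - f \<in> adic_ideal N" "g' - g \<in> adic_ideal N"
      using f g unfolding mem_closure_iff_adic by blast
    then have "f' + g' - (f + g) \<in> adic_ideal N"
      unfolding diff_mem_adic_ideal_iff by (simp add: plus_mps_def)
    with h show "\<exists>h\<in>B. h - (f + g) \<in> adic_ideal N" using assms unfolding mps_subalgebra_def by blast
    from h show "\<exists>h\<in>B. h - f * g \<in> adic_ideal N"
      using assms mult_cong_adic_ideal unfolding mps_subalgebra_def by blast
  qed
  then show "f + g \<in> closure B" "f * g \<in> closure B" unfolding mem_closure_iff_adic by blast+
qed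

lemma mps_subalgebra_power_series_algebra:
  "mps_subalgebra (power_series_algebra (T :: ('k::field, 'n::finite) mps set))"
proof -
  have "mps_subalgebra (\<Inter>\<B>)" if "Ball \<B> mps_subalgebra" for \<B> :: "('k, 'n) mps set set"
    using that unfolding mps_subalgebra_def by blast
  then have "mps_subalgebra (mps_subalgebra hull T)" by (rule hull_in)
  then show ?thesis unfolding power_series_algebra_def by (rule mps_subalgebra_closure)
qed

section \<open>Initial forms and cones\<close>

text \<open>Induction on the set of coordinates that are compared. To add a coordinate \<open>j\<close>, let \<open>N\<close> bound the
  \<open>j\<close>-th entries of a finite set that works for the earlier coordinates: it still works for vectors
  with a larger \<open>j\<close>-th entry, and each of the finitely many slices with \<open>j\<close>-th entry at most \<open>N\<close> has a
  finite set of its own, on which the \<open>j\<close>-th entry is constant.\<close>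

lemma Dickson:
  fixes X :: "(nat ^ 'n::finite) set"
  shows "\<exists>F\<subseteq>X. finite F \<and> (\<forall>x\<in>X. \<exists>y\<in>F. \<forall>i. y $ i \<le> x $ i)"
proof -
  have "\<exists>F\<subseteq>X. finite F \<and> (\<forall>x\<in>X. \<exists>y\<in>F. \<forall>i\<in>I. y $ i \<le> x $ i)"
    if "finite I" for I :: "'n set" and X :: "(nat ^ 'n) set"
    using that
  proof (induction I arbitrary: X)
    case empty
    show ?case
    proof (cases "X = {}")
      case False
      then obtain x where "x \<in> X" by blast
      then show ?thesis by (intro exI[of _ "{x}"]) auto
    qed auto
  next
    case (insert j I)
    obtain F where F: "F \<subseteq> X" "finite F" "\<And>x. x \<in> X \<Longrightarrow> \<exists>y\<in>F. \<forall>i\<in>I. y $ i \<le> x $ i"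
      using insert.IH[of X] by blast
    obtain N where N: "\<And>y. y \<in> F \<Longrightarrow> y $ j \<le> N"
      using finite_nat_set_iff_bounded_le[of "(\<lambda>y. y $ j) ` F"] F(2) by blast
    have "\<forall>m. \<exists>H. H \<subseteq> {x\<in>X. x $ j = m} \<and> finite H \<and>
        (\<forall>x\<in>{x\<in>X. x $ j = m}. \<exists>y\<in>H. \<forall>i\<in>I. y $ i \<le> x $ i)"
      using insert.IH by blast
    from choice[OF this] obtain H where "\<forall>m. H m \<subseteq> {x\<in>X. x $ j = m} \<and> finite (H m) \<and>
        (\<forall>x\<in>{x\<in>X. x $ j = m}. \<exists>y\<in>H m. \<forall>i\<in>I. y $ i \<le> x $ i)" ..
    then have H: "\<And>m. H m \<subseteq> {x\<in>X. x $ j = m}" "\<And>m. finite (H m)"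
      "\<And>m x. x \<in> X \<Longrightarrow> x $ j = m \<Longrightarrow> \<exists>y\<in>H m. \<forall>i\<in>I. y $ i \<le> x $ i"
      by auto
    show ?case
    proof (intro exI conjI ballI)
      show "F \<union> (\<Union>m\<le>N. H m) \<subseteq> X" "finite (F \<union> (\<Union>m\<le>N. H m))"
        using F(1,2) H(1,2) by (blast, simp)
      fix x assume x: "x \<in> X"
      show "\<exists>y\<in>F \<union> (\<Union>m\<le>N. H m). \<forall>i\<in>insert j I. y $ i \<le> x $ i"
      proof (cases "x $ j \<le> N")
        case True
        obtain y where y: "y \<in> H (x $ j)" "\<forall>i\<in>I. y $ i \<le> x $ i" using H(3)[OF x refl] by blast
        then have "y $ j = x $ j" using H(1) by blast
        with y True show ?thesis by (intro bexI[of _ y]) auto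
      next
        case False
        obtain y where y: "y \<in> F" "\<forall>i\<in>I. y $ i \<le> x $ i" using F(3)[OF x] by blast
        with N[OF y(1)] False show ?thesis by (intro bexI[of _ y]) auto
      qed
    qed
  qed
  from this[of UNIV X] show ?thesis by simp
qed

lemma ex_least_weight:
  assumes "a \<in> pos_orthant" "X \<noteq> {}"
  obtains \<mu> where "\<mu> \<in> X" "\<And>\<beta>. \<beta> \<in> X \<Longrightarrow> weight a \<mu> \<le> weight a \<beta>"
proof -
  obtain \<gamma> where \<gamma>: "\<gamma> \<in> X" using assms(2) by blast
  let ?L = "{\<beta>\<in>X. weight a \<beta> \<le> weight a \<gamma>}"
  have L: "finite ?L" by (rule finite_subset[OF _ finite_weight_le[OF assms(1), of "weight a \<gamma>"]]) auto
  obtain \<mu> where \<mu>: "\<mu> \<in> ?L" "\<And>\<beta>. \<beta> \<in> ?L \<Longrightarrow> weight a \<mu> \<le> weight a \<beta>"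
    using that ex_is_arg_min_if_finite[OF L, of "weight a"] \<gamma> by (auto simp: is_arg_min_linorder)
  show ?thesis
  proof
    show "\<mu> \<in> X" using \<mu>(1) by simp
    show "weight a \<mu> \<le> weight a \<beta>" if "\<beta> \<in> X" for \<beta>
      using \<mu>(1) \<mu>(2)[of \<beta>] that by (cases "weight a \<beta> \<le> weight a \<gamma>") auto
  qed
qed

lemma Supp_initial_form:
  assumes "a \<in> pos_orthant"
  shows "\<alpha> \<in> Supp (initial_form f a) \<longleftrightarrow>
    \<alpha> \<in> Supp f \<and> (\<forall>\<beta>\<in>Supp f. weight a \<alpha> \<le> weight a \<beta>)"
proof (cases "Supp f = {}")
  case True
  then show ?thesis by (auto simp: Supp_def initial_form_def)
next
  case False
  then obtain \<mu> where \<mu>: "\<mu> \<in> Supp f" "\<And>\<beta>. \<beta> \<in> Supp f \<Longrightarrow> weight a \<mu> \<le> weight a \<beta>"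
    using ex_least_weight[OF assms] by metis
  then have "min_weight f a = weight a \<mu>"
    unfolding min_weight_def by (intro Least_equality) auto
  then show ?thesis using \<mu> by (auto simp: Supp_def initial_form_def intro: antisym)
qed

text \<open>An initial form keeps the coefficients of the series, so its support determines it.\<close>

lemma initial_form_eq_iff:
  "initial_form f c = initial_form f d \<longleftrightarrow> Supp (initial_form f c) = Supp (initial_form f d)"
proof
  assume S: "Supp (initial_form f c) = Supp (initial_form f d)"
  have "mcoeff (initial_form f c) \<alpha> = (if \<alpha> \<in> Supp (initial_form f c) then mcoeff f \<alpha> else 0)" for c \<alpha>
    by (auto simp: Supp_def initial_form_def)
  then show "initial_form f c = initial_form f d" using S by (intro mps_eqI) simp
qed simp

text \<open>Replacing an exponent by a smaller one lowers a positive weight, so exponents of least weight are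
  minimal and belong to every set \<open>F\<close> that bounds the support from below.\<close>

lemma Supp_initial_form_subset:
  assumes a: "a \<in> pos_orthant" and F: "F \<subseteq> Supp f" "\<And>x. x \<in> Supp f \<Longrightarrow> \<exists>y\<in>F. \<forall>i. y $ i \<le> x $ i"
  shows "Supp (initial_form f a) \<subseteq> F"
proof
  fix \<alpha> assume \<alpha>: "\<alpha> \<in> Supp (initial_form f a)"
  then obtain y where y: "y \<in> F" "\<forall>i. y $ i \<le> \<alpha> $ i"
    using F(2) Supp_initial_form[OF a] by blast
  have "weight a \<alpha> \<le> weight a y" using \<alpha> F(1) y(1) unfolding Supp_initial_form[OF a] by blast
  then have "\<not> weight a y < weight a \<alpha>" by simp
  then have "y = \<alpha>" using weight_strict_mono[OF a] y(2) by blast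
  with y(1) show "\<alpha> \<in> F" by simp
qed

text \<open>Finitely many comparisons suffice when \<open>F\<close> is finite: every exponent of \<open>f\<close> weighs at least as much
  as some element of \<open>F\<close>, so the least weight is found within \<open>F\<close>.\<close>

lemma Supp_initial_form_eq_iff:
  assumes c: "c \<in> pos_orthant" and d: "d \<in> pos_orthant"
    and F: "F \<subseteq> Supp f" "\<And>x. x \<in> Supp f \<Longrightarrow> \<exists>y\<in>F. \<forall>i. y $ i \<le> x $ i"
  defines "T \<equiv> Supp (initial_form f d)"
  shows "Supp (initial_form f c) = T \<longleftrightarrow>
    (\<forall>\<alpha>\<in>T. \<forall>\<beta>\<in>T. weight c \<alpha> = weight c \<beta>) \<and> (\<forall>\<alpha>\<in>T. \<forall>\<beta>\<in>F - T. weight c \<alpha> < weight c \<beta>)"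
proof (intro iffI conjI ballI)
  assume e: "Supp (initial_form f c) = T"
  show "weight c \<alpha> = weight c \<beta>" if "\<alpha> \<in> T" "\<beta> \<in> T" for \<alpha> \<beta>
    using that unfolding e[symmetric] Supp_initial_form[OF c] by (auto intro: antisym)
  show "weight c \<alpha> < weight c \<beta>" if "\<alpha> \<in> T" "\<beta> \<in> F - T" for \<alpha> \<beta>
    using that F(1) unfolding e[symmetric] by (auto simp: Supp_initial_form[OF c] not_le)
next
  assume r: "(\<forall>\<alpha>\<in>T. \<forall>\<beta>\<in>T. weight c \<alpha> = weight c \<beta>) \<and>
    (\<forall>\<alpha>\<in>T. \<forall>\<beta>\<in>F - T. weight c \<alpha> < weight c \<beta>)"
  have TS: "T \<subseteq> Supp f" unfolding T_def using Supp_initial_form[OF d] by blast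
  have le: "weight c \<alpha> \<le> weight c \<beta>" if \<alpha>: "\<alpha> \<in> T" and \<beta>: "\<beta> \<in> Supp f" for \<alpha> \<beta>
  proof -
    obtain y where y: "y \<in> F" "\<forall>i. y $ i \<le> \<beta> $ i" using F(2)[OF \<beta>] by blast
    then have "weight c y \<le> weight c \<beta>" using weight_mono[OF c] by blast
    moreover have "weight c \<alpha> = weight c y \<or> weight c \<alpha> < weight c y" using r \<alpha> y(1) by blast
    ultimately show ?thesis by linarith
  qed
  show "Supp (initial_form f c) = T"
  proof (intro equalityI subsetI)
    fix \<alpha> assume "\<alpha> \<in> T"
    then show "\<alpha> \<in> Supp (initial_form f c)" using TS le by (auto simp: Supp_initial_form[OF c])
  next
    fix \<beta> assume \<beta>: "\<beta> \<in> Supp (initial_form f c)"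
    then have "\<beta> \<in> F" using Supp_initial_form_subset[OF c F] by blast
    have "Supp f \<noteq> {}" using \<beta> by (auto simp: Supp_initial_form[OF c])
    then obtain \<alpha> where \<alpha>: "\<alpha> \<in> T"
      using ex_least_weight[OF d] unfolding T_def Supp_initial_form[OF d] by metis
    show "\<beta> \<in> T"
    proof (rule ccontr)
      assume "\<beta> \<notin> T"
      with \<open>\<beta> \<in> F\<close> \<alpha> r have "weight c \<alpha> < weight c \<beta>" by blast
      moreover have "weight c \<beta> \<le> weight c \<alpha>" using \<beta> \<alpha> TS by (auto simp: Supp_initial_form[OF c])
      ultimately show False by simp
    qed
  qed
qed

definition exponent_vector :: "nat ^ 'n::finite \<Rightarrow> real ^ 'n" where
  "exponent_vector \<alpha> = (\<chi> i. real (\<alpha> $ i))"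

lemma inner_exponent_vector: "exponent_vector \<alpha> \<bullet> a = weight a \<alpha>"
  by (simp add: exponent_vector_def weight_def inner_vec_def mult.commute)

lemma convex_pos_orthant: "convex (pos_orthant :: (real ^ 'n::finite) set)"
proof -
  have "pos_orthant = (\<Inter>i. {x :: real ^ 'n. axis i 1 \<bullet> x > 0})"
    by (auto simp: pos_orthant_def inner_axis' )
  moreover have "convex (\<Inter>i. {x :: real ^ 'n. axis i 1 \<bullet> x > 0})"
    by (intro convex_INT convex_halfspace_gt)
  ultimately show ?thesis by simp
qed

lemma rational_polyhedral_coneI:
  fixes C :: "(real ^ 'n::finite) set"
  assumes "finite E" "finite P" "\<And>v i. v \<in> E \<union> P \<Longrightarrow> v $ i \<in> \<rat>"
    and C: "C = {x \<in> pos_orthant. (\<forall>v\<in>E. v \<bullet> x = 0) \<and> (\<forall>v\<in>P. 0 < v \<bullet> x)}"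
  shows "rational_polyhedral_cone C"
  unfolding rational_polyhedral_cone_def
proof (intro conjI exI)
  have "C = pos_orthant \<inter> (\<Inter>v\<in>E. {x. v \<bullet> x = 0}) \<inter> (\<Inter>v\<in>P. {x. v \<bullet> x > 0})"
    unfolding C by auto
  moreover have "convex \<dots>"
    by (intro convex_Int convex_INT convex_pos_orthant convex_hyperplane convex_halfspace_gt)
  ultimately show "convex C" by simp
  show "\<forall>t>0. \<forall>x\<in>C. t *\<^sub>R x \<in> C" unfolding C by (auto simp: pos_orthant_def)
  show "finite E" "finite P" "finite ({} :: (real ^ 'n) set)" "\<forall>v\<in>E \<union> P \<union> {}. \<forall>i. v $ i \<in> \<rat>"
    using assms by auto
  show "C = {x \<in> pos_orthant. (\<forall>v\<in>E. v \<bullet> x = 0) \<and> (\<forall>v\<in>P. 0 < v \<bullet> x) \<and> (\<forall>v\<in>{}. 0 \<le> v \<bullet> x)}"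
    unfolding C by simp
qed

text \<open>The defining vectors are the differences \<open>\<beta> - \<alpha>\<close>, where \<open>\<alpha>\<close> belongs to the prescribed support;
  they give equations when \<open>\<beta>\<close> does too, and strict inequalities for the other elements
  of a finite set that bounds the support of the series from below.\<close>

lemma initial_form_class_cone:
  fixes G :: "('k::zero, 'n::finite) mps set"
  assumes G: "finite G" and d: "d \<in> pos_orthant"
  shows "rational_polyhedral_cone {c \<in> pos_orthant. \<forall>g\<in>G. initial_form g c = initial_form g d}"
proof -
  have "\<forall>g :: ('k, 'n) mps. \<exists>F. F \<subseteq> Supp g \<and> finite F \<and> (\<forall>x\<in>Supp g. \<exists>y\<in>F. \<forall>i. y $ i \<le> x $ i)"
    using Dickson by blast
  then obtain F where F: "\<And>g :: ('k, 'n) mps. F g \<subseteq> Supp g" "\<And>g :: ('k, 'n) mps. finite (F g)"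
    "\<And>(g :: ('k, 'n) mps) x. x \<in> Supp g \<Longrightarrow> \<exists>y\<in>F g. \<forall>i. y $ i \<le> x $ i"
    by metis
  define T where "T g = Supp (initial_form g d)" for g :: "('k, 'n) mps"
  have fT: "finite (T g)" for g
    unfolding T_def using Supp_initial_form_subset[OF d F(1,3)] F(2) finite_subset by blast
  define \<delta> where "\<delta> = (\<lambda>(\<alpha> :: nat ^ 'n, \<beta>). exponent_vector \<beta> - exponent_vector \<alpha>)"
  define E where "E = \<delta> ` (\<Union>g\<in>G. T g \<times> T g)"
  define P where "P = \<delta> ` (\<Union>g\<in>G. T g \<times> (F g - T g))"
  show ?thesis
  proof (rule rational_polyhedral_coneI)
    show "finite E" "finite P" unfolding E_def P_def using G fT F(2) by auto
    show "v $ i \<in> \<rat>" if "v \<in> E \<union> P" for v i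
      using that by (auto simp: E_def P_def \<delta>_def exponent_vector_def)
    have "(\<forall>g\<in>G. initial_form g c = initial_form g d) \<longleftrightarrow>
        (\<forall>v\<in>E. v \<bullet> c = 0) \<and> (\<forall>v\<in>P. 0 < v \<bullet> c)" if c: "c \<in> pos_orthant" for c
    proof -
      have "(\<forall>g\<in>G. initial_form g c = initial_form g d) \<longleftrightarrow>
          (\<forall>g\<in>G. (\<forall>\<alpha>\<in>T g. \<forall>\<beta>\<in>T g. weight c \<alpha> = weight c \<beta>) \<and>
            (\<forall>\<alpha>\<in>T g. \<forall>\<beta>\<in>F g - T g. weight c \<alpha> < weight c \<beta>))"
        unfolding initial_form_eq_iff T_def
        by (intro ball_cong refl Supp_initial_form_eq_iff[OF c d F(1,3)])
      also have "\<dots> \<longleftrightarrow> (\<forall>v\<in>E. v \<bullet> c = 0) \<and> (\<forall>v\<in>P. 0 < v \<bullet> c)"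
      proof -
        have \<delta>: "\<delta> p \<bullet> c = weight c (snd p) - weight c (fst p)" for p
          by (simp add: \<delta>_def case_prod_beta inner_diff_left inner_exponent_vector)
        have "(\<forall>v\<in>E. v \<bullet> c = 0) \<longleftrightarrow> (\<forall>g\<in>G. \<forall>\<alpha>\<in>T g. \<forall>\<beta>\<in>T g. weight c \<beta> = weight c \<alpha>)"
          unfolding E_def by (simp add: \<delta>)
        moreover have "(\<forall>v\<in>P. 0 < v \<bullet> c) \<longleftrightarrow>
            (\<forall>g\<in>G. \<forall>\<alpha>\<in>T g. \<forall>\<beta>\<in>F g - T g. weight c \<alpha> < weight c \<beta>)"
          unfolding P_def by (simp add: \<delta> split_paired_Ball_Sigma)
        ultimately show ?thesis by metis
      qed
      finally show ?thesis .
    qed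
    then show "{c \<in> pos_orthant. \<forall>g\<in>G. initial_form g c = initial_form g d} =
      {c \<in> pos_orthant. (\<forall>v\<in>E. v \<bullet> c = 0) \<and> (\<forall>v\<in>P. 0 < v \<bullet> c)}" by blast
  qed
qed

lemma finite_initial_forms:
  fixes g :: "('k::zero, 'n::finite) mps"
  shows "finite (initial_form g ` pos_orthant)"
proof -
  obtain F where F: "F \<subseteq> Supp g" "finite F" "\<And>x. x \<in> Supp g \<Longrightarrow> \<exists>y\<in>F. \<forall>i. y $ i \<le> x $ i"
    using Dickson[of "Supp g"] by blast
  have "Supp ` initial_form g ` pos_orthant \<subseteq> Pow F"
    using Supp_initial_form_subset[OF _ F(1,3)] by blast
  then have "finite (Supp ` initial_form g ` pos_orthant)"
    using F(2) by (meson finite_Pow_iff finite_subset)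
  moreover have "inj_on Supp (initial_form g ` pos_orthant)"
    by (auto simp: inj_on_def initial_form_eq_iff)
  ultimately show ?thesis by (rule finite_imageD)
qed

lemma equiv_same_initial_forms: "equiv pos_orthant (same_initial_forms G)"
  by (rule equivI) (auto simp: same_initial_forms_def refl_on_def sym_def trans_def)

lemma same_initial_forms_class:
  "d \<in> pos_orthant \<Longrightarrow> same_initial_forms G `` {d} =
    {c \<in> pos_orthant. \<forall>g\<in>G. initial_form g c = initial_form g d}"
  by (auto simp: same_initial_forms_def)

text \<open>A class is determined by the family of initial forms that its members share, and each of the
  finitely many series has finitely many initial forms.\<close>

lemma finite_same_initial_forms_classes:
  fixes G :: "('k::zero, 'n::finite) mps set"
  assumes "finite G"
  shows "finite (pos_orthant // same_initial_forms G)"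
proof -
  define \<Phi> where "\<Phi> = (\<lambda>c. restrict (\<lambda>g. initial_form g c) G)"
  have \<Phi>: "\<Phi> c = \<Phi> d \<longleftrightarrow> (\<forall>g\<in>G. initial_form g c = initial_form g d)" for c d
    by (auto simp: \<Phi>_def restrict_def fun_eq_iff)
  have "\<Phi> ` pos_orthant \<subseteq> (\<Pi>\<^sub>E g\<in>G. initial_form g ` pos_orthant)" by (auto simp: \<Phi>_def)
  then have "finite (\<Phi> ` pos_orthant)"
    by (rule finite_subset) (intro finite_PiE assms finite_initial_forms)
  moreover have "pos_orthant // same_initial_forms G \<subseteq>
      (\<lambda>\<phi>. {c \<in> pos_orthant. \<Phi> c = \<phi>}) ` \<Phi> ` pos_orthant"
  proof
    fix C assume "C \<in> pos_orthant // same_initial_forms G"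
    then obtain d where d: "d \<in> pos_orthant" "C = same_initial_forms G `` {d}" by (rule quotientE)
    then have "C = {c \<in> pos_orthant. \<Phi> c = \<Phi> d}" by (simp add: same_initial_forms_class \<Phi>)
    with d(1) show "C \<in> (\<lambda>\<phi>. {c \<in> pos_orthant. \<Phi> c = \<phi>}) ` \<Phi> ` pos_orthant" by blast
  qed
  ultimately show ?thesis by (meson finite_imageI finite_subset)
qed

theorem proposition42:
  fixes r :: "(nat ^ 'n::finite) rel"
    and f :: "nat \<Rightarrow> ('k::field, 'n) mps"
    and s :: nat
    and A G :: "('k, 'n) mps set"
    and S :: "(nat ^ 'n) set"
    and a :: "real ^ 'n"
  assumes "exponent_order r"
    and "\<forall>i\<in>{1..s}. f i \<noteq> 0"
    and "A = power_series_algebra (f ` {1..s})"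
    and "\<forall>b\<in>pos_orthant. finitely_generated (lead_exps r A b)"
    and "finite (lead_algebra r A ` pos_orthant)"
    and "finitely_generated S"
    and "a \<in> exp_region r A S"
    and "reduced_canonical_basis r A a G"
  shows "(\<forall>b\<in>exp_region r A S. reduced_canonical_basis r A b G) \<and>
    equiv pos_orthant (same_initial_forms G) \<and>
    partition_on pos_orthant (pos_orthant // same_initial_forms G) \<and>
    finite (pos_orthant // same_initial_forms G) \<and>
    (\<forall>C\<in>pos_orthant // same_initial_forms G. rational_polyhedral_cone C) \<and>
    (\<exists>\<C>\<subseteq>pos_orthant // same_initial_forms G. exp_region r A S = \<Union>\<C>)"
proof -
  have r: "exponent_order r" by (rule assms(1))
  have A: "mps_subalgebra A" unfolding assms(3) by (rule mps_subalgebra_power_series_algebra)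
  have a: "a \<in> pos_orthant" "lead_exps r A a = S" using assms(7) by (auto simp: exp_region_def)
  have red: "reduced_canonical_basis r A b G" if "b \<in> exp_region r A S" for b
    using reduced_canonical_basis_cong[OF r a(1) _ A _ assms(8)] that a(2)
    by (auto simp: exp_region_def)
  have G: "finite G" using assms(8)
    by (auto simp: reduced_canonical_basis_def minimal_canonical_basis_def canonical_basis_def)
  have cone: "rational_polyhedral_cone C" if "C \<in> pos_orthant // same_initial_forms G" for C
    using that initial_form_class_cone[OF G] by (auto elim!: quotientE simp: same_initial_forms_class)
  have sat: "c \<in> exp_region r A S"
    if b: "b \<in> exp_region r A S" and bc: "(b, c) \<in> same_initial_forms G" for b c
  proof -
    have bp: "b \<in> pos_orthant" "lead_exps r A b = S" using b by (auto simp: exp_region_def)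
    have cp: "c \<in> pos_orthant" using bc by (simp add: same_initial_forms_def)
    have "canonical_basis r A b G"
      using red[OF b] by (simp add: reduced_canonical_basis_def minimal_canonical_basis_def)
    then have "G \<subseteq> A - {0}" "subsemigroup hull ((\<lambda>g. lead_exp r g b) ` G) = lead_exps r A b"
      by (auto simp: canonical_basis_def)
    moreover have "lead_exp r g c = lead_exp r g b" if "g \<in> G" for g
      using bc that by (simp add: same_initial_forms_def lead_exp_def)
    ultimately have "lead_exps r A c = lead_exps r A b"
      by (rule lead_exps_eq_if_lead_exps_basis_eq[OF r bp(1) cp A])
    then show ?thesis using cp bp(2) by (simp add: exp_region_def)
  qed
  let ?\<C> = "(\<lambda>b. same_initial_forms G `` {b}) ` exp_region r A S"
  have "?\<C> \<subseteq> pos_orthant // same_initial_forms G"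
    by (auto simp: exp_region_def intro: quotientI)
  moreover have "exp_region r A S = \<Union>?\<C>"
    using sat by (auto simp: exp_region_def same_initial_forms_def)
  ultimately have "\<exists>\<C>\<subseteq>pos_orthant // same_initial_forms G. exp_region r A S = \<Union>\<C>" by metis
  then show ?thesis
    using red equiv_same_initial_forms[of G] partition_on_quotient[OF equiv_same_initial_forms[of G]]
      finite_same_initial_forms_classes[OF G] cone
    by simp
qed

end
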